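(* Let $(\rho,\overline{J})$ be a charge distribution and current satisfying the continuity equation $\frac{\partial\rho}{\partial t}+\nabla\cdot\overline{J}=0$ in the rest frame $S$, and suppose that $(\rho,\overline{J})$ is mixed non-radiating, but not non-radiating. Then $(\rho,\overline{J})$ is trivial, that is, $\rho=0$ and $\overline{J}=\overline{0}$.
   Context: All quantities are smooth functions of space and time, with charges scalar valued and currents and fields vector valued. $\epsilon_{0},\mu_{0}>0$ are constants and $c=1/\sqrt{\mu_{0}\epsilon_{0}}$. Maxwell's equations for $(\rho,\overline{J},\overline{E},\overline{B})$ are: $\nabla\cdot\overline{E}=\rho/\epsilon_{0}$, $\nabla\cdot\overline{B}=0$, $\nabla\times\overline{E}=-\frac{\partial\overline{B}}{\partial t}$, $\nabla\times\overline{B}=\mu_{0}\overline{J}+\mu_{0}\epsilon_{0}\frac{\partial\overline{E}}{\partial t}$. The inertial frame $S'$ with velocity vector $\overline{v}$ relative to $S$, $v=|\overline{v}|<c$, has coordinates $(\overline{x}',t')$ given by the Lorentz transformation $\overline{x}'_{||}=\gamma(\overline{x}_{||}-\overline{v}t)$, $\overline{x}'_{\perp}=\overline{x}_{\perp}$, $t'=\gamma(t-\overline{v}\cdot\overline{x}/c^{2})$, with $\gamma=(1-v^{2}/c^{2})^{-1/2}$, where $||$ and $\perp$ denote the components parallel and perpendicular to $\overline{v}$ (the case $\overline{v}=\overline{0}$ is $S$ itself). The transformed charge and current are $\rho'=\gamma(\rho-vJ_{||}/c^{2})$ and $\overline{J}'=\gamma(\overline{J}_{||}-\rho\overline{v})+\overline{J}_{\perp}$,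 where $vJ_{||}=\overline{v}\cdot\overline{J}$, regarded as functions of $(\overline{x}',t')$. Maxwell's equations in $S'$ are the same equations with respect to the coordinates $(\overline{x}',t')$. Definitions, for $(\rho,\overline{J})$ satisfying the continuity equation in $S$: $(\rho,\overline{J})$ is non-radiating if in any inertial frame $S'$, with velocity vector $\overline{v}$, for the transformed current and charge $(\rho',\overline{J}')$, there exist electric and magnetic fields $(\overline{E}',\overline{B}')$ in $S'$ such that $(\rho',\overline{J}',\overline{E}',\overline{B}')$ satisfy Maxwell's equations in $S'$ and $\overline{B}'=\overline{0}$. $(\rho,\overline{J})$ is mixed non-radiating if in any inertial frame $S'$, with velocity vector $\overline{v}$, for the transformed current and charge $(\rho',\overline{J}')$, there exist electric and magnetic fields $(\overline{E}',\overline{B}')$ in $S'$ such that $(\rho',\overline{J}',\overline{E}',\overline{B}')$ satisfy Maxwell's equations in $S'$ and either $\overline{E}'=\overline{0}$ or $\overline{B}'=\overline{0}$. *)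

theory Defs
  imports "HOL-Analysis.Analysis"
begin

text \<open>Space-time points are pairs \<open>(x, t)\<close>, so the derivatives and the smoothness below are joint
  in space and time. All charges, currents and fields are functions on the whole of space-time.\<close>

type_synonym event = "(real^3) \<times> real"

primrec times_cont_differentiable ::
  "nat \<Rightarrow> ('a::real_normed_vector \<Rightarrow> 'b::real_normed_vector) \<Rightarrow> bool" where
  "times_cont_differentiable 0 f \<longleftrightarrow> continuous_on UNIV f"
| "times_cont_differentiable (Suc k) f \<longleftrightarrow>
     (\<forall>x. f differentiable (at x)) \<and>
     (\<forall>h. times_cont_differentiable k (\<lambda>x. frechet_derivative f (at x) h))"

definition smooth :: "('a::real_normed_vector \<Rightarrow> 'b::real_normed_vector) \<Rightarrow> bool" where
  "smooth f \<longleftrightarrow> (\<forall>k. times_cont_differentiable k f)"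

definition space_deriv :: "3 \<Rightarrow> (event \<Rightarrow> 'b::real_normed_vector) \<Rightarrow> event \<Rightarrow> 'b" where
  "space_deriv i f p = frechet_derivative f (at p) (axis i 1, 0)"

definition time_deriv :: "(event \<Rightarrow> 'b::real_normed_vector) \<Rightarrow> event \<Rightarrow> 'b" where
  "time_deriv f p = frechet_derivative f (at p) (0, 1)"

definition div_field :: "(event \<Rightarrow> real^3) \<Rightarrow> event \<Rightarrow> real" where
  "div_field F p = (\<Sum>i\<in>UNIV. space_deriv i F p $ i)"

definition curl_field :: "(event \<Rightarrow> real^3) \<Rightarrow> event \<Rightarrow> real^3" where
  "curl_field F p = vector
     [space_deriv 2 F p $ 3 - space_deriv 3 F p $ 2,
      space_deriv 3 F p $ 1 - space_deriv 1 F p $ 3,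
      space_deriv 1 F p $ 2 - space_deriv 2 F p $ 1]"

definition continuity_equation :: "(event \<Rightarrow> real) \<Rightarrow> (event \<Rightarrow> real^3) \<Rightarrow> bool" where
  "continuity_equation \<rho> J \<longleftrightarrow> (\<forall>p. time_deriv \<rho> p + div_field J p = 0)"

definition maxwell ::
  "real \<Rightarrow> real \<Rightarrow> (event \<Rightarrow> real) \<Rightarrow> (event \<Rightarrow> real^3) \<Rightarrow>
   (event \<Rightarrow> real^3) \<Rightarrow> (event \<Rightarrow> real^3) \<Rightarrow> bool" where
  "maxwell \<epsilon>0 \<mu>0 \<rho> J E B \<longleftrightarrow>
     (\<forall>p. div_field E p = \<rho> p / \<epsilon>0) \<and>
     (\<forall>p. div_field B p = 0) \<and>
     (\<forall>p. curl_field E p = - time_deriv B p) \<and>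
     (\<forall>p. curl_field B p = \<mu>0 *\<^sub>R J p + (\<mu>0 * \<epsilon>0) *\<^sub>R time_deriv E p)"

definition light_speed :: "real \<Rightarrow> real \<Rightarrow> real" where
  "light_speed \<epsilon>0 \<mu>0 = 1 / sqrt (\<mu>0 * \<epsilon>0)"

text \<open>For \<open>v = 0\<close> division by zero makes the parallel component \<open>0\<close> and the perpendicular
  one \<open>x\<close>, so that the transformations below become the identity.\<close>

definition par :: "real^3 \<Rightarrow> real^3 \<Rightarrow> real^3" where
  "par v x = ((v \<bullet> x) / (v \<bullet> v)) *\<^sub>R v"

definition perp :: "real^3 \<Rightarrow> real^3 \<Rightarrow> real^3" where
  "perp v x = x - par v x"

definition lorentz_factor :: "real \<Rightarrow> real^3 \<Rightarrow> real" where
  "lorentz_factor c v = 1 / sqrt (1 - (norm v)\<^sup>2 / c\<^sup>2)"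

definition lorentz :: "real \<Rightarrow> real^3 \<Rightarrow> event \<Rightarrow> event" where
  "lorentz c v = (\<lambda>(x, t).
     (lorentz_factor c v *\<^sub>R (par v x - t *\<^sub>R v) + perp v x,
      lorentz_factor c v * (t - (v \<bullet> x) / c\<^sup>2)))"

lemma lorentz_minus_lorentz:
  assumes "norm v < c"
  shows "lorentz c (- v) (lorentz c v p) = p"
proof (cases "v = 0")
  case True
  then show ?thesis
    by (cases p) (simp add: lorentz_def lorentz_factor_def par_def perp_def)
next
  case False
  obtain x t where p: "p = (x, t)" by (cases p)
  define g where "g = lorentz_factor c v"
  define a where "a = v \<bullet> x"
  define n where "n = v \<bullet> v"
  have n: "n > 0" and nv: "(norm v)\<^sup>2 = n"
    using False by (auto simp: n_def power2_norm_eq_inner)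
  have c: "c > 0" using assms norm_ge_zero[of v] by linarith
  have "n < c\<^sup>2" using assms nv by (metis norm_ge_zero power_strict_mono zero_less_numeral)
  then have pos: "1 - n / c\<^sup>2 > 0" using c by (simp add: field_simps)
  then have g2: "g\<^sup>2 * (1 - n / c\<^sup>2) = 1"
    using \<open>n < c\<^sup>2\<close> c
    by (simp add: g_def lorentz_factor_def nv power_divide del: diff_gt_0_iff_gt)
  have gm: "lorentz_factor c (- v) = g" by (simp add: g_def lorentz_factor_def)
  define y where "y = g *\<^sub>R (par v x - t *\<^sub>R v) + perp v x"
  define s where "s = g * (t - a / c\<^sup>2)"
  have y: "y = x + (g * (a / n - t) - a / n) *\<^sub>R v"
    by (simp add: y_def perp_def par_def a_def n_def algebra_simps)
  have vy: "v \<bullet> y = g * (a - t * n)"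
    using n by (simp add: y inner_add_right a_def[symmetric] n_def[symmetric] field_simps)
  have time: "g * (s + v \<bullet> y / c\<^sup>2) = t"
  proof -
    have "g * (s + v \<bullet> y / c\<^sup>2) = t * (g\<^sup>2 * (1 - n / c\<^sup>2))"
      using c by (simp add: s_def vy power2_eq_square divide_simps) (simp add: algebra_simps)
    then show ?thesis by (simp add: g2)
  qed
  have coeff: "g * (v \<bullet> y / n + s) - v \<bullet> y / n + (g * (a / n - t) - a / n) = 0"
  proof -
    have "g * (v \<bullet> y / n + s) = a / n * (g\<^sup>2 * (1 - n / c\<^sup>2))"
      using n c by (simp add: s_def vy power2_eq_square divide_simps) (simp add: algebra_simps)
    moreover have "v \<bullet> y / n = g * (a / n - t)" using n by (simp add: vy field_simps)
    ultimately show ?thesis by (simp add: g2)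
  qed
  have "lorentz c (- v) (y, s) =
     (y + (g * (v \<bullet> y / n + s) - v \<bullet> y / n) *\<^sub>R v, g * (s + v \<bullet> y / c\<^sup>2))"
    by (simp add: lorentz_def gm perp_def par_def n_def algebra_simps)
  also have "\<dots> = (x + (g * (v \<bullet> y / n + s) - v \<bullet> y / n + (g * (a / n - t) - a / n)) *\<^sub>R v, t)"
    by (subst (1) y) (simp add: time scaleR_add_left scaleR_diff_left)
  also have "\<dots> = p" by (simp add: coeff p)
  finally show ?thesis
    by (simp add: p lorentz_def y_def s_def a_def g_def)
qed

lemma bij_lorentz:
  assumes "norm v < c"
  shows "bij (lorentz c v)"
  by (rule o_bij[where g = "lorentz c (- v)"])
    (use assms lorentz_minus_lorentz[of v c] lorentz_minus_lorentz[of "- v" c] in \<open>auto simp: fun_eq_iff\<close>)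

text \<open>The transformed charge and current are functions of the coordinates of the moving frame,
  hence the inverse Lorentz transformation.\<close>

definition transformed_charge ::
  "real \<Rightarrow> real^3 \<Rightarrow> (event \<Rightarrow> real) \<Rightarrow> (event \<Rightarrow> real^3) \<Rightarrow> event \<Rightarrow> real" where
  "transformed_charge c v \<rho> J q =
     (let p = inv (lorentz c v) q
      in lorentz_factor c v * (\<rho> p - (v \<bullet> J p) / c\<^sup>2))"

definition transformed_current ::
  "real \<Rightarrow> real^3 \<Rightarrow> (event \<Rightarrow> real) \<Rightarrow> (event \<Rightarrow> real^3) \<Rightarrow> event \<Rightarrow> real^3" where
  "transformed_current c v \<rho> J q =
     (let p = inv (lorentz c v) q
      in lorentz_factor c v *\<^sub>R (par v (J p) - \<rho> p *\<^sub>R v) + perp v (J p))"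

definition non_radiating ::
  "real \<Rightarrow> real \<Rightarrow> (event \<Rightarrow> real) \<Rightarrow> (event \<Rightarrow> real^3) \<Rightarrow> bool" where
  "non_radiating \<epsilon>0 \<mu>0 \<rho> J \<longleftrightarrow>
     (let c = light_speed \<epsilon>0 \<mu>0 in
      \<forall>v. norm v < c \<longrightarrow>
        (\<exists>E B. smooth E \<and> smooth B \<and>
           maxwell \<epsilon>0 \<mu>0 (transformed_charge c v \<rho> J) (transformed_current c v \<rho> J) E B \<and>
           B = (\<lambda>_. 0)))"

definition mixed_non_radiating ::
  "real \<Rightarrow> real \<Rightarrow> (event \<Rightarrow> real) \<Rightarrow> (event \<Rightarrow> real^3) \<Rightarrow> bool" where
  "mixed_non_radiating \<epsilon>0 \<mu>0 \<rho> J \<longleftrightarrow>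
     (let c = light_speed \<epsilon>0 \<mu>0 in
      \<forall>v. norm v < c \<longrightarrow>
        (\<exists>E B. smooth E \<and> smooth B \<and>
           maxwell \<epsilon>0 \<mu>0 (transformed_charge c v \<rho> J) (transformed_current c v \<rho> J) E B \<and>
           (E = (\<lambda>_. 0) \<or> B = (\<lambda>_. 0))))"

end

theory Submission
  imports Defs
begin

text \<open>The four-current \<open>j = (J, \<rho>)\<close> is a vector field on space-time; the transformed source in the
  frame with velocity \<open>v\<close> is its conjugate under the boost. Lowering an index with the Minkowski form
  and taking the exterior derivative attaches to \<open>j\<close> a skew-symmetric form at every event, called
  its vorticity here, which does not depend on the frame (\<open>vorticity_lorentz\<close>).

  Both alternatives in the definition of mixed non-radiating constrain this form. If \<open>E' = 0\<close> in a
  frame \<open>w\<close>, there is no charge and the current is static and free of divergence, so the time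
  direction of \<open>w\<close> annihilates the vorticity (\<open>maxwell_electric_zero\<close>). If \<open>B' = 0\<close> in a frame
  \<open>v\<close>, the current \<open>- \<epsilon>0 \<partial>E'/\<partial>t'\<close> is free of curl, so the vorticity vanishes on the spatial
  directions of \<open>v\<close> (\<open>maxwell_magnetic_zero\<close>). A timelike vector and a spacelike hyperplane span
  space-time, so if both alternatives occur, in whatever frames, the vorticity is zero
  (\<open>vorticity_eq_zero\<close>).

  A source that is not non-radiating has a frame \<open>w\<close> without solution with \<open>B' = 0\<close>; there
  \<open>E' = 0\<close> is possible. Suppose that some frame carries a charge. In that frame \<open>B' = 0\<close>, so the
  vorticity is zero and the static current in \<open>w\<close> has no curl. But then \<open>- (t' / \<epsilon>0) J'\<close> is an
  electric field that solves Maxwell's equations in \<open>w\<close> together with \<open>B' = 0\<close>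
  (\<open>maxwell_static_current\<close>), a contradiction. Hence no frame carries a charge:
  \<open>\<rho> = v \<bullet> J / c\<^sup>2\<close> for all subluminal \<open>v\<close>. Taking \<open>v = 0\<close> and then \<open>v\<close> parallel to \<open>J\<close> gives
  \<open>\<rho> = 0\<close> and \<open>J = 0\<close>.\<close>

section \<open>Smooth functions and mixed derivatives\<close>

lemma frechet_derivative_eqI: "(f has_derivative f') (at x) \<Longrightarrow> frechet_derivative f (at x) h = f' h"
  by (drule frechet_derivative_at) simp

lemma times_cont_differentiable_bounded_linear:
  assumes A: "bounded_linear A" and "times_cont_differentiable k f"
  shows "times_cont_differentiable k (\<lambda>x. A (f x))"
  using assms(2)
proof (induction k arbitrary: f)
  case 0
  then show ?case
    by (auto intro!: bounded_linear.continuous_on[OF A])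
next
  case (Suc k)
  have d: "((\<lambda>x. A (f x)) has_derivative (\<lambda>h. A (frechet_derivative f (at x) h))) (at x)" for x
    using Suc.prems by (auto intro!: bounded_linear.has_derivative[OF A]
        simp: frechet_derivative_works[symmetric])
  have "frechet_derivative (\<lambda>x. A (f x)) (at x) = (\<lambda>h. A (frechet_derivative f (at x) h))" for x
    using frechet_derivative_at[OF d] by simp
  moreover have "(\<lambda>x. A (f x)) differentiable (at x)" for x
    using d differentiableI by blast
  ultimately show ?case
    using Suc by simp
qed

lemma times_cont_differentiable_add:
  assumes "times_cont_differentiable k f" "times_cont_differentiable k g"
  shows "times_cont_differentiable k (\<lambda>x. f x + g x)"
  using assms
proof (induction k arbitrary: f g)
  case 0
  then show ?case by (auto intro!: continuous_intros)
next
  case (Suc k)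
  have d: "((\<lambda>x. f x + g x) has_derivative
      (\<lambda>h. frechet_derivative f (at x) h + frechet_derivative g (at x) h)) (at x)" for x
    using Suc.prems by (auto intro!: has_derivative_add
        simp: frechet_derivative_works[symmetric])
  have "frechet_derivative (\<lambda>x. f x + g x) (at x) =
      (\<lambda>h. frechet_derivative f (at x) h + frechet_derivative g (at x) h)" for x
    using frechet_derivative_at[OF d] by simp
  moreover have "(\<lambda>x. f x + g x) differentiable (at x)" for x
    using d differentiableI by blast
  ultimately show ?case
    using Suc by simp
qed

lemma smooth_bounded_linear:
  "bounded_linear A \<Longrightarrow> smooth f \<Longrightarrow> smooth (\<lambda>x. A (f x))"
  by (simp add: smooth_def times_cont_differentiable_bounded_linear)

lemma smooth_add: "smooth f \<Longrightarrow> smooth g \<Longrightarrow> smooth (\<lambda>x. f x + g x)"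
  by (simp add: smooth_def times_cont_differentiable_add)

lemma smooth_differentiable: "smooth f \<Longrightarrow> f differentiable (at x)"
  unfolding smooth_def by (metis times_cont_differentiable.simps(2))

lemma smooth_has_derivative: "smooth f \<Longrightarrow> (f has_derivative frechet_derivative f (at x)) (at x)"
  using smooth_differentiable frechet_derivative_works by blast

lemma smooth_continuous: "smooth f \<Longrightarrow> continuous_on UNIV f"
  unfolding smooth_def by (metis times_cont_differentiable.simps(1))

lemma smooth_directional_derivative:
  "smooth f \<Longrightarrow> smooth (\<lambda>x. frechet_derivative f (at x) h)"
  unfolding smooth_def by (metis times_cont_differentiable.simps(2))

text \<open>The linear factor keeps the induction within this shape: a directional derivative of
  \<open>A x *\<^sub>R G x\<close> is \<open>A x *\<^sub>R G' x\<close>, with the derivative \<open>G'\<close> of \<open>G\<close> in that direction, plus a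
  constant multiple of \<open>G x\<close>.\<close>

lemma smooth_linear_scaleR:
  assumes A: "bounded_linear (A :: _ \<Rightarrow> real)" and "smooth G"
  shows "smooth (\<lambda>x. A x *\<^sub>R G x)"
proof -
  have "times_cont_differentiable k (\<lambda>x. A x *\<^sub>R G x)" if "smooth G" for k and G :: "'a \<Rightarrow> 'b"
    using that
  proof (induction k arbitrary: G)
    case 0
    then show ?case
      by (simp add: continuous_on_scaleR linear_continuous_on[OF A] smooth_continuous)
  next
    case (Suc k)
    have d: "((\<lambda>x. A x *\<^sub>R G x) has_derivative
        (\<lambda>h. A x *\<^sub>R frechet_derivative G (at x) h + A h *\<^sub>R G x)) (at x)" for x
      by (intro has_derivative_scaleR bounded_linear_imp_has_derivative A
          smooth_has_derivative Suc.prems)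
    have eq: "frechet_derivative (\<lambda>x. A x *\<^sub>R G x) (at x) =
        (\<lambda>h. A x *\<^sub>R frechet_derivative G (at x) h + A h *\<^sub>R G x)" for x
      using frechet_derivative_at[OF d] by simp
    have "(\<lambda>x. A x *\<^sub>R G x) differentiable (at x)" for x
      using d differentiableI by blast
    moreover have "times_cont_differentiable k
        (\<lambda>x. A x *\<^sub>R frechet_derivative G (at x) h + A h *\<^sub>R G x)" for h
      by (intro times_cont_differentiable_add Suc.IH smooth_directional_derivative
          times_cont_differentiable_bounded_linear[OF bounded_linear_scaleR_right])
        (use Suc.prems in \<open>auto simp: smooth_def\<close>)
    ultimately show ?case
      by (simp add: eq)
  qed
  then show ?thesis
    using assms(2) by (simp add: smooth_def)
qed

text \<open>Two applications of the mean value theorem, along \<open>h\<close> and then along \<open>k\<close>. The second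
  difference on the left is symmetric in \<open>h\<close> and \<open>k\<close> while the right-hand side is not; letting
  \<open>e\<close> tend to \<open>0\<close> is what makes mixed derivatives commute.\<close>

lemma second_difference_mean_value:
  fixes f :: "'a::real_normed_vector \<Rightarrow> real"
  assumes "smooth f" and e: "e > 0"
  shows "\<exists>\<sigma> \<tau>. 0 \<le> \<sigma> \<and> \<sigma> \<le> e \<and> 0 \<le> \<tau> \<and> \<tau> \<le> e \<and>
    f (p + e *\<^sub>R h + e *\<^sub>R k) - f (p + e *\<^sub>R h) - f (p + e *\<^sub>R k) + f p =
    e * (e * frechet_derivative (\<lambda>x. frechet_derivative f (at x) h) (at (p + \<sigma> *\<^sub>R h + \<tau> *\<^sub>R k)) k)"
proof -
  let ?D = "\<lambda>x. frechet_derivative f (at x) h"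
  have line: "((\<lambda>s. g (q + s *\<^sub>R w)) has_real_derivative
      frechet_derivative g (at (q + s *\<^sub>R w)) w) (at s)"
    if "smooth g" for g :: "'a \<Rightarrow> real" and q w s
  proof -
    have "((\<lambda>s. g (q + s *\<^sub>R w)) has_derivative
        (\<lambda>t. frechet_derivative g (at (q + s *\<^sub>R w)) (t *\<^sub>R w))) (at s)"
      by (rule has_derivative_compose[OF _ smooth_has_derivative[OF that]])
        (auto intro!: derivative_eq_intros)
    moreover have "frechet_derivative g (at (q + s *\<^sub>R w)) (t *\<^sub>R w) =
        t * frechet_derivative g (at (q + s *\<^sub>R w)) w" for t
      using linear_scale[OF linear_frechet_derivative[OF smooth_differentiable[OF that]]] by simp
    ultimately show ?thesis
      by (simp add: has_field_derivative_def mult_commute_abs)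
  qed
  define g where "g = (\<lambda>s. f ((p + e *\<^sub>R k) + s *\<^sub>R h) - f (p + s *\<^sub>R h))"
  have "\<exists>\<sigma>. 0 < \<sigma> \<and> \<sigma> < e \<and>
      g e - g 0 = (e - 0) * (?D ((p + e *\<^sub>R k) + \<sigma> *\<^sub>R h) - ?D (p + \<sigma> *\<^sub>R h))"
    unfolding g_def by (rule MVT2[OF e]) (auto intro!: DERIV_diff line assms)
  then obtain \<sigma> where \<sigma>: "0 < \<sigma>" "\<sigma> < e"
      "g e - g 0 = e * (?D ((p + e *\<^sub>R k) + \<sigma> *\<^sub>R h) - ?D (p + \<sigma> *\<^sub>R h))" by auto
  have "\<exists>\<tau>. 0 < \<tau> \<and> \<tau> < e \<and>
      ?D ((p + \<sigma> *\<^sub>R h) + e *\<^sub>R k) - ?D ((p + \<sigma> *\<^sub>R h) + 0 *\<^sub>R k) =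
      (e - 0) * frechet_derivative ?D (at ((p + \<sigma> *\<^sub>R h) + \<tau> *\<^sub>R k)) k"
    by (rule MVT2[OF e]) (auto intro!: line smooth_directional_derivative assms)
  then obtain \<tau> where \<tau>: "0 < \<tau>" "\<tau> < e"
      "?D ((p + \<sigma> *\<^sub>R h) + e *\<^sub>R k) - ?D (p + \<sigma> *\<^sub>R h) =
       e * frechet_derivative ?D (at ((p + \<sigma> *\<^sub>R h) + \<tau> *\<^sub>R k)) k" by auto
  have swap: "(p + e *\<^sub>R k) + s *\<^sub>R h = (p + s *\<^sub>R h) + e *\<^sub>R k" for s
    by simp
  have "f (p + e *\<^sub>R h + e *\<^sub>R k) - f (p + e *\<^sub>R h) - f (p + e *\<^sub>R k) + f p = g e - g 0"
    by (simp add: g_def swap)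
  also have "\<dots> = e * (e * frechet_derivative ?D (at (p + \<sigma> *\<^sub>R h + \<tau> *\<^sub>R k)) k)"
    by (simp only: \<sigma>(3) swap \<tau>(3))
  finally show ?thesis
    using \<sigma>(1,2) \<tau>(1,2) less_imp_le by blast
qed

lemma mixed_derivatives_commute_real:
  fixes f :: "'a::real_normed_vector \<Rightarrow> real"
  assumes "smooth f"
  shows "frechet_derivative (\<lambda>x. frechet_derivative f (at x) h) (at p) k =
         frechet_derivative (\<lambda>x. frechet_derivative f (at x) k) (at p) h"
proof -
  let ?D = "\<lambda>h k x. frechet_derivative (\<lambda>x. frechet_derivative f (at x) h) (at x) k"
  define e where "e n = inverse (real (Suc n))" for n
  \<comment> \<open>The normalised second difference along \<open>h\<close> and \<open>k\<close>; both iterated derivatives are its limit.\<close>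
  define \<Delta> where "\<Delta> n = (f (p + e n *\<^sub>R h + e n *\<^sub>R k) - f (p + e n *\<^sub>R h) - f (p + e n *\<^sub>R k) + f p)
      / (e n * e n)" for n
  have e: "e n > 0" for n by (simp add: e_def)
  have e0: "e \<longlonglongrightarrow> 0"
    unfolding e_def by (rule LIMSEQ_inverse_real_of_nat)
  have *: "(\<lambda>n. (f (p + e n *\<^sub>R h + e n *\<^sub>R k) - f (p + e n *\<^sub>R h) - f (p + e n *\<^sub>R k) + f p)
      / (e n * e n)) \<longlonglongrightarrow> ?D h k p" for h k
  proof -
    have "\<forall>n. \<exists>\<sigma> \<tau>. 0 \<le> \<sigma> \<and> \<sigma> \<le> e n \<and> 0 \<le> \<tau> \<and> \<tau> \<le> e n \<and>
      f (p + e n *\<^sub>R h + e n *\<^sub>R k) - f (p + e n *\<^sub>R h) - f (p + e n *\<^sub>R k) + f p =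
      e n * (e n * ?D h k (p + \<sigma> *\<^sub>R h + \<tau> *\<^sub>R k))"
      using second_difference_mean_value[OF assms e] by blast
    then obtain \<sigma> \<tau> where st: "\<And>n. 0 \<le> \<sigma> n" "\<And>n. \<sigma> n \<le> e n" "\<And>n. 0 \<le> \<tau> n" "\<And>n. \<tau> n \<le> e n"
      and eq: "\<And>n. f (p + e n *\<^sub>R h + e n *\<^sub>R k) - f (p + e n *\<^sub>R h) - f (p + e n *\<^sub>R k) + f p =
      e n * (e n * ?D h k (p + \<sigma> n *\<^sub>R h + \<tau> n *\<^sub>R k))"
      by metis
    have "\<sigma> \<longlonglongrightarrow> 0" "\<tau> \<longlonglongrightarrow> 0"
      by (rule tendsto_sandwich[OF _ _ tendsto_const e0]; simp add: st)+
    then have "(\<lambda>n. p + \<sigma> n *\<^sub>R h + \<tau> n *\<^sub>R k) \<longlonglongrightarrow> p + 0 *\<^sub>R h + 0 *\<^sub>R k"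
      by (intro tendsto_intros)
    then have "(\<lambda>n. p + \<sigma> n *\<^sub>R h + \<tau> n *\<^sub>R k) \<longlonglongrightarrow> p"
      by simp
    moreover have "continuous_on UNIV (?D h k)"
      by (rule smooth_continuous[OF smooth_directional_derivative[OF
            smooth_directional_derivative[OF assms]]])
    ultimately have "(\<lambda>n. ?D h k (p + \<sigma> n *\<^sub>R h + \<tau> n *\<^sub>R k)) \<longlonglongrightarrow> ?D h k p"
      by (auto intro: continuous_on_tendsto_compose)
    moreover have "(f (p + e n *\<^sub>R h + e n *\<^sub>R k) - f (p + e n *\<^sub>R h) - f (p + e n *\<^sub>R k) + f p)
      / (e n * e n) = ?D h k (p + \<sigma> n *\<^sub>R h + \<tau> n *\<^sub>R k)" for n
      using e[of n] by (simp add: eq)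
    ultimately show ?thesis by simp
  qed
  have "\<Delta> \<longlonglongrightarrow> ?D h k p" "\<Delta> \<longlonglongrightarrow> ?D k h p"
    using *[of h k] *[of k h] by (simp_all add: \<Delta>_def[abs_def] algebra_simps)
  then show ?thesis
    by (rule LIMSEQ_unique)
qed

lemma mixed_derivatives_commute:
  fixes f :: "'a::real_normed_vector \<Rightarrow> 'b::real_inner"
  assumes f: "smooth f"
  shows "frechet_derivative (\<lambda>x. frechet_derivative f (at x) h) (at p) k =
         frechet_derivative (\<lambda>x. frechet_derivative f (at x) k) (at p) h"
proof -
  have c: "frechet_derivative (\<lambda>x. g x \<bullet> w) (at x) = (\<lambda>h. frechet_derivative g (at x) h \<bullet> w)"
    if "smooth g" for g :: "'a \<Rightarrow> 'b" and w x
    using frechet_derivative_at[OF has_derivative_inner_left[OF smooth_has_derivative[OF that]]]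
    by simp
  have "frechet_derivative (\<lambda>x. frechet_derivative f (at x) h) (at p) k \<bullet> w =
        frechet_derivative (\<lambda>x. frechet_derivative f (at x) k) (at p) h \<bullet> w" for w
    using mixed_derivatives_commute_real[OF smooth_bounded_linear[OF bounded_linear_inner_left f],
        of w h p k]
    by (simp add: c f smooth_directional_derivative)
  then show ?thesis
    using vector_eq_rdot by blast
qed

section \<open>Lorentz invariance of the vorticity of a four-current\<close>

lemma lorentz_time: "snd (lorentz c v a) = lorentz_factor c v * (snd a - (v \<bullet> fst a) / c\<^sup>2)"
  by (simp add: lorentz_def split_beta)

lemma lorentz_space: "fst (lorentz c v a) =
    lorentz_factor c v *\<^sub>R (par v (fst a) - snd a *\<^sub>R v) + perp v (fst a)"
  by (simp add: lorentz_def split_beta)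

lemma bounded_linear_lorentz: "bounded_linear (lorentz c v)"
proof -
  have "linear (lorentz c v)"
    by (rule linearI)
      (simp_all add: prod_eq_iff lorentz_time lorentz_space par_def perp_def inner_add_right
        algebra_simps add_divide_distrib)
  then show ?thesis
    by (simp add: linear_conv_bounded_linear)
qed

lemma lorentz_lorentz_minus:
  "norm v < c \<Longrightarrow> lorentz c v (lorentz c (- v) p) = p"
  using lorentz_minus_lorentz[of "- v" c] by simp

lemma inv_lorentz: "norm v < c \<Longrightarrow> inv (lorentz c v) = lorentz c (- v)"
  by (rule inv_unique_comp) (auto simp: fun_eq_iff lorentz_minus_lorentz lorentz_lorentz_minus)

lemma subluminal:
  assumes "norm v < c"
  shows "c > 0" "v \<bullet> v < c\<^sup>2"
  using assms norm_ge_zero[of v] power_strict_mono[of "norm v" c 2]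
  by (auto simp: power2_norm_eq_inner simp del: norm_ge_zero)

lemma lorentz_factor_square:
  assumes "norm v < c"
  shows "(lorentz_factor c v)\<^sup>2 = c\<^sup>2 / (c\<^sup>2 - v \<bullet> v)"
  using subluminal[OF assms]
  by (simp add: lorentz_factor_def power2_norm_eq_inner power_divide field_simps)

lemma lorentz_factor_pos: "norm v < c \<Longrightarrow> lorentz_factor c v > 0"
  using subluminal[of v c]
  by (simp add: lorentz_factor_def power2_norm_eq_inner field_simps)

definition minkowski :: "real \<Rightarrow> event \<Rightarrow> event \<Rightarrow> real" where
  "minkowski c a b = fst a \<bullet> fst b - c\<^sup>2 * (snd a * snd b)"

lemma minkowski_commute: "minkowski c a b = minkowski c b a"
  by (simp add: minkowski_def inner_commute mult.commute)

lemma minkowski_add_left: "minkowski c (a + a') b = minkowski c a b + minkowski c a' b"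
  by (simp add: minkowski_def algebra_simps)

lemma minkowski_scaleR_left: "minkowski c (r *\<^sub>R a) b = r * minkowski c a b"
  by (simp add: minkowski_def algebra_simps)

text \<open>A boost changes the position only by a multiple \<open>\<alpha>\<close> of \<open>v\<close>, so the claim involves nothing
  but the times and the components along \<open>v\<close>, and reduces to
  \<open>\<gamma>\<^sup>2 = c\<^sup>2 / (c\<^sup>2 - v \<bullet> v)\<close>.\<close>

lemma minkowski_lorentz:
  assumes v: "norm v < c"
  shows "minkowski c (lorentz c v a) (lorentz c v b) = minkowski c a b"
proof (cases "v = 0")
  case True
  then show ?thesis
    by (simp add: minkowski_def lorentz_time lorentz_space lorentz_factor_def par_def perp_def)
next
  case False
  define g n where "g = lorentz_factor c v" and "n = v \<bullet> v"
  define A B where "A = v \<bullet> fst a" and "B = v \<bullet> fst b"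
  define \<alpha> \<beta> where "\<alpha> = g * (A / n - snd a) - A / n" and "\<beta> = g * (B / n - snd b) - B / n"
  have n: "n > 0" using False by (simp add: n_def)
  have c: "c > 0" "n < c\<^sup>2" using subluminal[OF v] by (simp_all add: n_def)
  have g2: "g\<^sup>2 = c\<^sup>2 / (c\<^sup>2 - n)"
    using lorentz_factor_square[OF v] by (simp add: g_def n_def)
  have sa: "fst (lorentz c v a) = fst a + \<alpha> *\<^sub>R v"
    by (simp add: lorentz_space perp_def par_def \<alpha>_def A_def n_def g_def algebra_simps)
  have sb: "fst (lorentz c v b) = fst b + \<beta> *\<^sub>R v"
    by (simp add: lorentz_space perp_def par_def \<beta>_def B_def n_def g_def algebra_simps)
  have "fst (lorentz c v a) \<bullet> fst (lorentz c v b) =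
      fst a \<bullet> fst b + (\<alpha> * B + \<beta> * A + \<alpha> * \<beta> * n)"
    by (simp add: sa sb inner_add_left inner_add_right A_def B_def n_def
        inner_commute[of "fst a" v] algebra_simps)
  also have "\<alpha> * B + \<beta> * A + \<alpha> * \<beta> * n = ((\<alpha> * n + A) * (\<beta> * n + B) - A * B) / n"
    using n by (simp add: field_simps)
  also have "\<alpha> * n + A = g * (A - snd a * n)"
    using n by (simp add: \<alpha>_def field_simps)
  also have "\<beta> * n + B = g * (B - snd b * n)"
    using n by (simp add: \<beta>_def field_simps)
  finally have 1: "fst (lorentz c v a) \<bullet> fst (lorentz c v b) =
      fst a \<bullet> fst b + (g\<^sup>2 * ((A - snd a * n) * (B - snd b * n)) - A * B) / n"
    by (simp add: power2_eq_square algebra_simps)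
  have 2: "snd (lorentz c v a) * snd (lorentz c v b) =
      g\<^sup>2 * ((snd a - A / c\<^sup>2) * (snd b - B / c\<^sup>2))"
    by (simp add: lorentz_time g_def A_def B_def power2_eq_square algebra_simps)
  have "(g\<^sup>2 * ((A - snd a * n) * (B - snd b * n)) - A * B) / n -
      c\<^sup>2 * (g\<^sup>2 * ((snd a - A / c\<^sup>2) * (snd b - B / c\<^sup>2))) = - c\<^sup>2 * (snd a * snd b)"
  proof -
    define s t k d where "s = snd a" and "t = snd b" and "k = c\<^sup>2" and "d = k - n"
    have k: "k > 0" "d > 0" "k = d + n" using c by (simp_all add: k_def d_def)
    have "(k / d * ((A - s * n) * (B - t * n)) - A * B) / n -
        k * (k / d * ((s - A / k) * (t - B / k))) = - k * (s * t)"
      using k(1,2) n by (simp add: divide_simps) (simp add: k(3) algebra_simps)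
    then show ?thesis
      by (simp add: g2 s_def t_def k_def d_def)
  qed
  then show ?thesis
    by (simp add: minkowski_def 1 2)
qed

text \<open>This is the exterior derivative of the one-form dual to \<open>j\<close> under the Minkowski form. For
  \<open>j = (J, \<rho>)\<close> its components on two spatial vectors are those of \<open>\<nabla> \<times> J\<close>, and its components
  on a temporal and a spatial vector are those of \<open>\<partial>J/\<partial>t + c\<^sup>2 \<nabla>\<rho>\<close>.\<close>

definition vorticity :: "real \<Rightarrow> (event \<Rightarrow> event) \<Rightarrow> event \<Rightarrow> event \<Rightarrow> event \<Rightarrow> real" where
  "vorticity c j p h k =
     minkowski c (frechet_derivative j (at p) h) k - minkowski c (frechet_derivative j (at p) k) h"

lemma has_derivative_lorentz_conjugate:
  assumes "\<And>p. j differentiable (at p)"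
  shows "((\<lambda>q. lorentz c v (j (lorentz c (- v) q))) has_derivative
    (\<lambda>h. lorentz c v (frechet_derivative j (at (lorentz c (- v) q)) (lorentz c (- v) h)))) (at q)"
  by (intro bounded_linear.has_derivative[OF bounded_linear_lorentz]
      has_derivative_compose[OF bounded_linear_imp_has_derivative[OF bounded_linear_lorentz]])
    (use assms frechet_derivative_works in blast)

text \<open>The vorticity is built from a derivative and the Minkowski form alone, so a boost, which
  preserves the form, merely relabels its arguments.\<close>

lemma vorticity_lorentz:
  assumes v: "norm v < c" and j: "\<And>p. j differentiable (at p)"
  shows "vorticity c (\<lambda>q. lorentz c v (j (lorentz c (- v) q))) (lorentz c v p)
           (lorentz c v h) (lorentz c v k) = vorticity c j p h k"
  by (simp add: vorticity_def minkowski_lorentz lorentz_minus_lorentz v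
      frechet_derivative_eqI[OF has_derivative_lorentz_conjugate[OF j]])

lemma vorticity_skew: "vorticity c j p k h = - vorticity c j p h k"
  by (simp add: vorticity_def)

lemma vorticity_add_left:
  assumes "j differentiable (at p)"
  shows "vorticity c j p (h + h') k = vorticity c j p h k + vorticity c j p h' k"
  by (simp add: vorticity_def linear_add[OF linear_frechet_derivative[OF assms]]
      minkowski_add_left minkowski_commute[of c _ "h + h'"] minkowski_commute[of c _ h]
      minkowski_commute[of c _ h'])

lemma vorticity_scaleR_left:
  assumes "j differentiable (at p)"
  shows "vorticity c j p (r *\<^sub>R h) k = r * vorticity c j p h k"
  by (simp add: vorticity_def linear_scale[OF linear_frechet_derivative[OF assms]]
      minkowski_scaleR_left minkowski_commute[of c _ "r *\<^sub>R h"] minkowski_commute[of c _ h]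
      algebra_simps)

text \<open>The time direction of the frame with velocity \<open>w\<close>, seen from the rest frame, is
  \<open>T = lorentz c (- w) (0, 1)\<close>. Being timelike, \<open>T\<close> is never purely spatial in
  any frame \<open>v\<close>, so it spans space-time together with the spatial directions of \<open>v\<close>. A
  skew-symmetric form that is annihilated by \<open>T\<close> and vanishes on those directions is zero.\<close>

lemma vorticity_eq_zero:
  assumes v: "norm v < c" "norm w < c" and j: "j differentiable (at p)"
    and time: "\<And>k. vorticity c j p (lorentz c (- w) (0, 1)) k = 0"
    and space: "\<And>h k. snd (lorentz c v h) = 0 \<Longrightarrow> snd (lorentz c v k) = 0 \<Longrightarrow> vorticity c j p h k = 0"
  shows "vorticity c j p h k = 0"
proof -
  define T where "T = lorentz c (- w) (0, 1)"
  define \<tau> where "\<tau> h = snd (lorentz c v h)" for h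
  have \<tau>: "linear \<tau>"
    unfolding \<tau>_def
    by (intro linear_compose[OF bounded_linear.linear[OF bounded_linear_lorentz] linear_snd, unfolded o_def])
  \<comment> \<open>Up to positive factors \<open>\<tau> T\<close> is \<open>1 - (v \<bullet> w) / c\<^sup>2\<close>, positive for subluminal velocities.\<close>
  have "\<tau> T \<noteq> 0"
  proof -
    have "\<bar>v \<bullet> w\<bar> \<le> norm v * norm w" by (rule Cauchy_Schwarz_ineq2)
    also have "\<dots> < c * c"
      using v subluminal[OF v(1)] by (intro mult_strict_mono') auto
    finally have "0 < 1 - (v \<bullet> w) / c\<^sup>2"
      using subluminal[OF v(1)] by (simp add: field_simps power2_eq_square)
    moreover have "lorentz_factor c (- w) > 0" "lorentz_factor c v > 0"
      using v by (simp_all add: lorentz_factor_pos)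
    moreover have "\<tau> T = lorentz_factor c v * (lorentz_factor c (- w) * (1 - (v \<bullet> w) / c\<^sup>2))"
      by (simp add: \<tau>_def T_def lorentz_time lorentz_space par_def perp_def algebra_simps)
    ultimately have "\<tau> T > 0"
      by (metis mult_pos_pos)
    then show ?thesis by simp
  qed
  have split: "\<exists>r h'. h = r *\<^sub>R T + h' \<and> \<tau> h' = 0" for h
    using \<open>\<tau> T \<noteq> 0\<close>
    by (intro exI[of _ "\<tau> h / \<tau> T"] exI[of _ "h - (\<tau> h / \<tau> T) *\<^sub>R T"])
      (simp add: linear_diff[OF \<tau>] linear_scale[OF \<tau>])
  obtain r h' where h: "h = r *\<^sub>R T + h'" "\<tau> h' = 0" using split by blast
  obtain s k' where k: "k = s *\<^sub>R T + k'" "\<tau> k' = 0" using split by blast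
  have T0: "vorticity c j p T x = 0" "vorticity c j p x T = 0" for x
    using time[of x] vorticity_skew[of c j p x T] by (simp_all add: T_def)
  have "vorticity c j p h k = vorticity c j p h' k"
    by (simp add: h vorticity_add_left vorticity_scaleR_left j T0)
  also have "\<dots> = - vorticity c j p k h'"
    by (rule vorticity_skew)
  also have "vorticity c j p k h' = vorticity c j p k' h'"
    by (simp add: k vorticity_add_left vorticity_scaleR_left j T0)
  also have "\<dots> = 0"
    using space h k by (simp add: \<tau>_def)
  finally show ?thesis by simp
qed

section \<open>Sources without electric or without magnetic field\<close>

lemma frechet_derivative_bounded_linear_comp:
  assumes "bounded_linear A" and "f differentiable (at x)"
  shows "frechet_derivative (\<lambda>x. A (f x)) (at x) h = A (frechet_derivative f (at x) h)"
  by (rule frechet_derivative_eqI[OF bounded_linear.has_derivative[OF assms(1)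
        iffD1[OF frechet_derivative_works assms(2)]]])

lemma frechet_derivative_space:
  assumes "F differentiable (at p)"
  shows "frechet_derivative F (at p) (h, 0) = (\<Sum>i\<in>UNIV. h $ i *\<^sub>R space_deriv i F p)"
proof -
  have "(h, 0::real) = (\<Sum>i\<in>UNIV. h $ i *\<^sub>R (axis i 1, 0))"
    by (simp add: prod_eq_iff fst_sum snd_sum vec_eq_iff axis_def if_distrib cong: if_cong)
  then show ?thesis
    by (simp add: space_deriv_def linear_sum[OF linear_frechet_derivative[OF assms]]
        linear_scale[OF linear_frechet_derivative[OF assms]] del: scaleR_Pair)
qed

lemma curl_field_eq_0_iff_symmetric:
  assumes "F differentiable (at p)"
  shows "curl_field F p = 0 \<longleftrightarrow>
    (\<forall>h k. frechet_derivative F (at p) (h, 0) \<bullet> k = frechet_derivative F (at p) (k, 0) \<bullet> h)"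
proof
  assume "curl_field F p = 0"
  then have *: "space_deriv 2 F p $ 3 = space_deriv 3 F p $ 2"
      "space_deriv 3 F p $ 1 = space_deriv 1 F p $ 3"
      "space_deriv 1 F p $ 2 = space_deriv 2 F p $ 1"
    by (simp_all add: curl_field_def vec_eq_iff forall_3)
  show "\<forall>h k. frechet_derivative F (at p) (h, 0) \<bullet> k = frechet_derivative F (at p) (k, 0) \<bullet> h"
    by (simp add: frechet_derivative_space[OF assms] inner_vec_def sum_3 * algebra_simps)
next
  assume *: "\<forall>h k. frechet_derivative F (at p) (h, 0) \<bullet> k = frechet_derivative F (at p) (k, 0) \<bullet> h"
  have "space_deriv i F p $ j = space_deriv j F p $ i" for i j
    using *[rule_format, of "axis i 1" "axis j 1"] by (simp add: space_deriv_def inner_axis)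
  then show "curl_field F p = 0"
    by (simp add: curl_field_def vec_eq_iff forall_3)
qed

lemma bounded_linear_cross3: "bounded_linear (cross3 a)"
  using bilinear_cross by (simp add: bilinear_def linear_conv_bounded_linear)

lemma curl_field_cross3: "curl_field F p = (\<Sum>i\<in>UNIV. cross3 (axis i 1) (space_deriv i F p))"
  by (simp add: curl_field_def cross3_def vec_eq_iff forall_3 sum_3 axis_def)

lemma smooth_space_deriv: "smooth F \<Longrightarrow> smooth (space_deriv i F)"
  using smooth_directional_derivative by (simp add: space_deriv_def[abs_def])

lemma smooth_curl_field:
  assumes "smooth F"
  shows "smooth (curl_field F)"
  unfolding curl_field_cross3[abs_def] sum_3
  by (intro smooth_add smooth_bounded_linear[OF bounded_linear_cross3] smooth_space_deriv assms)

text \<open>Mixed derivatives commute, so a directional derivative passes through the curl. With the time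
  direction this shows that a field constant in time has a static curl, with spatial directions that
  a curl has no divergence.\<close>

lemma frechet_derivative_curl_field:
  assumes "smooth F"
  shows "frechet_derivative (curl_field F) (at p) h =
    (\<Sum>i\<in>UNIV. cross3 (axis i 1) (space_deriv i (\<lambda>x. frechet_derivative F (at x) h) p))"
proof -
  have "(curl_field F has_derivative (\<lambda>h. \<Sum>i\<in>UNIV. cross3 (axis i 1)
      (frechet_derivative (space_deriv i F) (at p) h))) (at p)"
    unfolding curl_field_cross3[abs_def]
    by (intro has_derivative_sum bounded_linear.has_derivative[OF bounded_linear_cross3]
        smooth_has_derivative smooth_space_deriv assms)
  then have "frechet_derivative (curl_field F) (at p) h = (\<Sum>i\<in>UNIV. cross3 (axis i 1)
      (frechet_derivative (space_deriv i F) (at p) h))"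
    by (rule frechet_derivative_eqI)
  moreover have "frechet_derivative (space_deriv i F) (at p) h =
      space_deriv i (\<lambda>x. frechet_derivative F (at x) h) p" for i
    unfolding space_deriv_def[abs_def] by (rule mixed_derivatives_commute[OF assms])
  ultimately show ?thesis
    by simp
qed

lemma div_curl_field:
  assumes "smooth F"
  shows "div_field (curl_field F) p = 0"
proof -
  let ?D = "\<lambda>i j. space_deriv i (space_deriv j F) p"
  have "?D i j = ?D j i" for i j
    using mixed_derivatives_commute[OF assms] by (simp add: space_deriv_def[abs_def])
  from this[of 2 1] this[of 3 1] this[of 3 2]
  have sym: "?D 2 1 = ?D 1 2" "?D 3 1 = ?D 1 3" "?D 3 2 = ?D 2 3" .
  have "space_deriv i (curl_field F) p = (\<Sum>j\<in>UNIV. cross3 (axis j 1) (?D j i))" for i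
    using frechet_derivative_curl_field[OF assms, of p "(axis i 1, 0)"]
    by (simp add: space_deriv_def[abs_def])
  then show ?thesis
    by (simp add: div_field_def sum_3 cross3_def axis_def sym)
qed

lemma curl_field_zero [simp]: "curl_field (\<lambda>_. 0) p = 0"
  by (simp add: curl_field_def space_deriv_def vec_eq_iff forall_3)

lemma div_field_zero [simp]: "div_field (\<lambda>_. 0) p = 0"
  by (simp add: div_field_def space_deriv_def)

text \<open>Without electric field Gauss's law leaves no charge, Faraday's law makes \<open>B\<close> constant in
  time, and Ampere's law makes the current a multiple of \<open>\<nabla> \<times> B\<close>, which is therefore constant in
  time as well and free of divergence.\<close>

lemma maxwell_electric_zero:
  assumes "\<epsilon>0 > 0" "\<mu>0 > 0" "smooth B" and mx: "maxwell \<epsilon>0 \<mu>0 \<rho> J (\<lambda>_. 0) B"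
  shows "\<rho> p = 0" and "smooth J" and "frechet_derivative J (at p) (0, 1) = 0" and "div_field J p = 0"
proof -
  show "\<rho> p = 0"
    using mx assms(1) by (simp add: maxwell_def del: split_paired_All)
  have J: "J = (\<lambda>p. (1 / \<mu>0) *\<^sub>R curl_field B p)"
    using mx assms(2) by (simp add: maxwell_def time_deriv_def fun_eq_iff)
  show "smooth J"
    unfolding J by (rule smooth_bounded_linear[OF bounded_linear_scaleR_right smooth_curl_field[OF assms(3)]])
  have D: "frechet_derivative J (at p) h = (1 / \<mu>0) *\<^sub>R frechet_derivative (curl_field B) (at p) h" for h
    unfolding J by (rule frechet_derivative_bounded_linear_comp[OF bounded_linear_scaleR_right
          smooth_differentiable[OF smooth_curl_field[OF assms(3)]]])
  have "(\<lambda>x. frechet_derivative B (at x) (0, 1)) = (\<lambda>_. 0)"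
    using mx by (simp add: maxwell_def time_deriv_def fun_eq_iff)
  then show "frechet_derivative J (at p) (0, 1) = 0"
    by (simp add: D frechet_derivative_curl_field assms space_deriv_def)
  show "div_field J p = 0"
    using div_curl_field[OF assms(3), of p]
    by (simp add: div_field_def space_deriv_def D flip: sum_divide_distrib)
qed

text \<open>Without magnetic field Ampere's law reads \<open>J = - \<epsilon>0 \<partial>E/\<partial>t\<close>, and \<open>E\<close> is free of curl by
  Faraday's law. Being free of curl means that the spatial Jacobian is symmetric, which passes to the
  time derivative because mixed derivatives commute.\<close>

lemma maxwell_magnetic_zero:
  assumes "\<epsilon>0 > 0" "\<mu>0 > 0" "smooth E" and mx: "maxwell \<epsilon>0 \<mu>0 \<rho> J E (\<lambda>_. 0)"
  shows "curl_field J p = 0"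
proof -
  let ?D = "\<lambda>h q. frechet_derivative E (at q) h"
  have sD: "smooth (?D h)" for h
    by (rule smooth_directional_derivative[OF assms(3)])
  have J: "J = (\<lambda>q. (- \<epsilon>0) *\<^sub>R ?D (0, 1) q)"
  proof
    fix q
    have "\<mu>0 *\<^sub>R (J q + \<epsilon>0 *\<^sub>R ?D (0, 1) q) = 0"
      using mx by (simp add: maxwell_def time_deriv_def scaleR_add_right del: split_paired_All)
    then show "J q = (- \<epsilon>0) *\<^sub>R ?D (0, 1) q"
      using assms(2) by (simp add: eq_neg_iff_add_eq_0)
  qed
  have sJ: "smooth J"
    unfolding J by (rule smooth_bounded_linear[OF bounded_linear_scaleR_right sD])
  have curl: "curl_field E q = 0" for q
    using mx by (simp add: maxwell_def time_deriv_def del: split_paired_All)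
  have "?D (h, 0) q \<bullet> k = ?D (k, 0) q \<bullet> h" for h k q
    using curl curl_field_eq_0_iff_symmetric[OF smooth_differentiable[OF assms(3)]] by blast
  then have "(\<lambda>q. ?D (h, 0) q \<bullet> k) = (\<lambda>q. ?D (k, 0) q \<bullet> h)" for h k
    by simp
  moreover have in_D: "frechet_derivative (\<lambda>q. ?D (h, 0) q \<bullet> k) (at p) (0, 1) =
      frechet_derivative (?D (h, 0)) (at p) (0, 1) \<bullet> k" for h k
    by (rule frechet_derivative_bounded_linear_comp[OF bounded_linear_inner_left
          smooth_differentiable[OF sD]])
  ultimately have "frechet_derivative (?D (h, 0)) (at p) (0, 1) \<bullet> k =
      frechet_derivative (?D (k, 0)) (at p) (0, 1) \<bullet> h" for h k
    by metis
  moreover have "frechet_derivative J (at p) (h, 0) =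
      (- \<epsilon>0) *\<^sub>R frechet_derivative (?D (h, 0)) (at p) (0, 1)" for h
    unfolding J
    by (subst frechet_derivative_bounded_linear_comp[OF bounded_linear_scaleR_right
          smooth_differentiable[OF sD]])
      (simp only: mixed_derivatives_commute[OF assms(3), of "(0, 1)"])
  ultimately show ?thesis
    by (simp add: curl_field_eq_0_iff_symmetric[OF smooth_differentiable[OF sJ]])
qed

text \<open>For a static current the field must grow linearly in time, since Ampere's law without
  magnetic field fixes \<open>\<partial>E/\<partial>t = - J / \<epsilon>0\<close>. The other equations then say precisely that the
  current has neither divergence nor curl.\<close>

lemma maxwell_static_current:
  fixes J :: "event \<Rightarrow> real^3"
  assumes "\<epsilon>0 > 0" and J: "smooth J"
    and static: "\<And>p. frechet_derivative J (at p) (0, 1) = 0"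
    and div: "\<And>p. div_field J p = 0" and curl: "\<And>p. curl_field J p = 0"
  defines "E \<equiv> \<lambda>q. - (snd q / \<epsilon>0) *\<^sub>R J q"
  shows "smooth E" and "maxwell \<epsilon>0 \<mu>0 (\<lambda>_. 0) J E (\<lambda>_. 0)"
proof -
  have bl: "bounded_linear (\<lambda>q::event. - (snd q / \<epsilon>0))"
    by (intro bounded_linear_minus bounded_linear_compose[OF bounded_linear_divide] bounded_linear_snd)
  show "smooth E"
    unfolding E_def by (rule smooth_linear_scaleR[OF bl J])
  have "(E has_derivative (\<lambda>h. - (snd p / \<epsilon>0) *\<^sub>R frechet_derivative J (at p) h
      + (- (snd h / \<epsilon>0)) *\<^sub>R J p)) (at p)" for p
    unfolding E_def
    by (intro has_derivative_scaleR bounded_linear_imp_has_derivative[OF bl] smooth_has_derivative J)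
  then have D: "frechet_derivative E (at p) h = - (snd p / \<epsilon>0) *\<^sub>R frechet_derivative J (at p) h
      + (- (snd h / \<epsilon>0)) *\<^sub>R J p" for p h
    by (rule frechet_derivative_eqI)
  have sp: "space_deriv i E p = - (snd p / \<epsilon>0) *\<^sub>R space_deriv i J p" for i p
    by (simp add: space_deriv_def D)
  have "div_field E p = - (snd p / \<epsilon>0) * div_field J p" for p
    by (simp add: div_field_def sp sum_distrib_left)
  moreover have "curl_field E p = - (snd p / \<epsilon>0) *\<^sub>R curl_field J p" for p
    by (simp add: curl_field_def sp vec_eq_iff forall_3 diff_divide_distrib right_diff_distrib)
  moreover have "time_deriv E p = - (1 / \<epsilon>0) *\<^sub>R J p" for p
    by (simp add: time_deriv_def D static)
  moreover have "time_deriv (\<lambda>_. 0 :: real^3) p = 0" for p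
    by (simp add: time_deriv_def)
  ultimately show "maxwell \<epsilon>0 \<mu>0 (\<lambda>_. 0) J E (\<lambda>_. 0)"
    using assms(1) by (simp add: maxwell_def div curl)
qed

section \<open>Comparison of frames\<close>

text \<open>Charge and current transform like time and position. The transformed source is thus the
  boosted four-current to which the invariance of the vorticity applies.\<close>

lemma transformed_four_current:
  assumes "norm v < c"
  shows "(transformed_current c v \<rho> J q, transformed_charge c v \<rho> J q) =
    lorentz c v (J (lorentz c (- v) q), \<rho> (lorentz c (- v) q))"
  by (simp add: transformed_current_def transformed_charge_def inv_lorentz assms
      prod_eq_iff lorentz_time lorentz_space Let_def)

lemma frechet_derivative_components:
  assumes "j differentiable (at p)"
  shows "frechet_derivative (\<lambda>q. fst (j q)) (at p) h = fst (frechet_derivative j (at p) h)"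
    and "frechet_derivative (\<lambda>q. snd (j q)) (at p) h = snd (frechet_derivative j (at p) h)"
  by (rule frechet_derivative_bounded_linear_comp[OF bounded_linear_fst assms]
      frechet_derivative_bounded_linear_comp[OF bounded_linear_snd assms])+

lemma vorticity_space:
  assumes "j differentiable (at p)"
  shows "vorticity c j p (h, 0) (k, 0) =
    frechet_derivative (\<lambda>q. fst (j q)) (at p) (h, 0) \<bullet> k -
    frechet_derivative (\<lambda>q. fst (j q)) (at p) (k, 0) \<bullet> h"
  by (simp add: vorticity_def minkowski_def frechet_derivative_components[OF assms])

lemma vorticity_time:
  assumes "j differentiable (at p)"
    and "\<And>q. snd (j q) = 0" and "frechet_derivative (\<lambda>q. fst (j q)) (at p) (0, 1) = 0"
  shows "vorticity c j p (0, 1) k = 0"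
proof -
  have "snd (frechet_derivative j (at p) h) = 0" for h
    using frechet_derivative_components(2)[OF assms(1), of h] assms(2) by simp
  then show ?thesis
    using assms(3)
    by (simp add: vorticity_def minkowski_def frechet_derivative_components[OF assms(1)])
qed

theorem lemma2p10:
  fixes \<epsilon>0 \<mu>0 :: real
    and \<rho> :: "event \<Rightarrow> real"
    and J :: "event \<Rightarrow> real^3"
  assumes "\<epsilon>0 > 0" and "\<mu>0 > 0"
    and "smooth \<rho>" and "smooth J"
    and "continuity_equation \<rho> J"
    and "mixed_non_radiating \<epsilon>0 \<mu>0 \<rho> J"
    and "\<not> non_radiating \<epsilon>0 \<mu>0 \<rho> J"
  shows "\<rho> = (\<lambda>_. 0) \<and> J = (\<lambda>_. 0)"
proof -
  define c where "c = light_speed \<epsilon>0 \<mu>0"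
  define j where "j = (\<lambda>p. (J p, \<rho> p))"
  define \<rho>' where "\<rho>' v = transformed_charge c v \<rho> J" for v
  define J' where "J' v = transformed_current c v \<rho> J" for v
  define j' where "j' v = (\<lambda>q. lorentz c v (j (lorentz c (- v) q)))" for v
  have c: "c > 0"
    using assms(1,2) by (simp add: c_def light_speed_def)
  have dj: "j differentiable (at p)" for p
    unfolding j_def
    by (rule differentiableI[OF has_derivative_Pair[OF smooth_has_derivative[OF assms(4)]
            smooth_has_derivative[OF assms(3)]]])
  have dj': "j' v differentiable (at q)" for v q
    unfolding j'_def
    by (rule differentiableI[OF has_derivative_lorentz_conjugate[OF dj]])
  have components: "fst (j' v q) = J' v q" "snd (j' v q) = \<rho>' v q" if "norm v < c" for v q
    using transformed_four_current[OF that, of \<rho> J q, symmetric]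
    by (simp_all add: j'_def j_def J'_def \<rho>'_def)
  have mixed: "\<exists>E B. smooth E \<and> smooth B \<and> maxwell \<epsilon>0 \<mu>0 (\<rho>' v) (J' v) E B \<and>
      (E = (\<lambda>_. 0) \<or> B = (\<lambda>_. 0))" if "norm v < c" for v
    using assms(6) that unfolding mixed_non_radiating_def c_def \<rho>'_def J'_def by meson
  obtain w where w: "norm w < c" and radiates:
    "\<And>E. smooth E \<Longrightarrow> \<not> maxwell \<epsilon>0 \<mu>0 (\<rho>' w) (J' w) E (\<lambda>_. 0)"
  proof -
    have "smooth (\<lambda>_::event. 0::real^3)"
      using smooth_bounded_linear[OF bounded_linear_zero assms(4)] .
    then show thesis
      using assms(7) that unfolding non_radiating_def c_def \<rho>'_def J'_def by meson
  qed
  \<comment> \<open>The frame \<open>w\<close> admits no solution without magnetic field, hence one without electric field.\<close>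
  obtain B where B: "smooth B" "maxwell \<epsilon>0 \<mu>0 (\<rho>' w) (J' w) (\<lambda>_. 0) B"
    using mixed[OF w] radiates by blast
  note static = maxwell_electric_zero[OF assms(1,2) B]
  have charge_zero: "\<rho>' v q = 0" if v: "norm v < c" for v q
  proof (rule ccontr)
    assume charged: "\<rho>' v q \<noteq> 0"
    obtain E where E: "smooth E" "maxwell \<epsilon>0 \<mu>0 (\<rho>' v) (J' v) E (\<lambda>_. 0)"
      using mixed[OF v] maxwell_electric_zero(1)[OF assms(1,2)] charged by metis
    \<comment> \<open>A charge in the frame \<open>v\<close> excludes \<open>E' = 0\<close> there, so the two frames are of different
      type and the vorticity has to vanish altogether.\<close>
    have vort: "vorticity c j p h k = 0" for p h k
    proof (rule vorticity_eq_zero[OF v w dj])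
      fix k
      have "vorticity c (j' w) (lorentz c w p) (0, 1) (lorentz c w k) = 0"
        by (rule vorticity_time[OF dj']) (simp_all add: components w static)
      then show "vorticity c j p (lorentz c (- w) (0, 1)) k = 0"
        using vorticity_lorentz[OF w dj, of p "lorentz c (- w) (0, 1)" k]
        by (simp add: j'_def lorentz_lorentz_minus w)
    next
      fix h k assume "snd (lorentz c v h) = 0" "snd (lorentz c v k) = 0"
      then obtain x y where xy: "lorentz c v h = (x, 0)" "lorentz c v k = (y, 0)"
        by (metis prod.collapse)
      have dJ: "J' v differentiable (at q)" for q
        using differentiableI[OF bounded_linear.has_derivative[OF bounded_linear_fst
              iffD1[OF frechet_derivative_works dj'[of v q]]]]
        by (simp add: components v)
      have "vorticity c (j' v) (lorentz c v p) (x, 0) (y, 0) = 0"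
        using maxwell_magnetic_zero[OF assms(1,2) E, of "lorentz c v p"]
        by (simp add: vorticity_space[OF dj'] components v curl_field_eq_0_iff_symmetric[OF dJ])
      then show "vorticity c j p h k = 0"
        using vorticity_lorentz[OF v dj, of p h k] by (simp add: j'_def xy)
    qed
    \<comment> \<open>The current of the frame \<open>w\<close> is then free of curl, which yields the excluded solution.\<close>
    have "curl_field (J' w) q = 0" for q
    proof -
      have "vorticity c (j' w) q (x, 0) (y, 0) = 0" for x y
        using vorticity_lorentz[OF w dj, of "lorentz c (- w) q" "lorentz c (- w) (x, 0)"
            "lorentz c (- w) (y, 0)"]
        by (simp add: j'_def lorentz_lorentz_minus w vort)
      then show ?thesis
        by (simp add: vorticity_space[OF dj'] components w
            curl_field_eq_0_iff_symmetric[OF smooth_differentiable[OF static(2)]])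
    qed
    then obtain E where "smooth E" "maxwell \<epsilon>0 \<mu>0 (\<lambda>_. 0) (J' w) E (\<lambda>_. 0)"
      using maxwell_static_current[OF assms(1) static(2-4)] by blast
    moreover have "\<rho>' w = (\<lambda>_. 0)"
      using static(1) by blast
    ultimately show False
      using radiates by simp
  qed
  have orth: "\<rho> p = (v \<bullet> J p) / c\<^sup>2" if v: "norm v < c" for v p
  proof -
    have "snd (lorentz c v (j p)) = 0"
      using charge_zero[OF v, of "lorentz c v p"] components(2)[OF v, of "lorentz c v p"]
      by (simp add: j'_def lorentz_minus_lorentz v)
    then show ?thesis
      using lorentz_factor_pos[OF v] by (simp add: lorentz_time j_def)
  qed
  have "\<rho> p = 0" for p
    using orth[of 0 p] c by simp
  moreover have "J p = 0" for p
  proof (rule ccontr)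
    assume "J p \<noteq> 0"
    define v where "v = (c / (2 * norm (J p))) *\<^sub>R J p"
    have "norm v < c"
      using c \<open>J p \<noteq> 0\<close> by (simp add: v_def)
    from orth[OF this, of p] have "v \<bullet> J p = 0"
      using \<open>\<rho> p = 0\<close> c by simp
    then show False
      using c \<open>J p \<noteq> 0\<close> by (simp add: v_def)
  qed
  ultimately show ?thesis by blast
qed

end
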